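(* Let $\eta_8=e^{2\pi i/8}$, let $G\subset GL_4(\mathbb{C})$ be the group generated by \[ \frac{\eta_8}{2}\begin{pmatrix}1&1&1&1\\1&i&-1&-i\\1&-1&1&-1\\1&-i&-1&i\end{pmatrix}\quad\text{and}\quad \mathrm{diag}[1,\eta_8,-1,\eta_8], \] and let $G^8$ be the group generated by $G$ and $\mathrm{diag}[\eta_8,\eta_8,\eta_8,\eta_8]$. For a finite group $\Gamma\subset GL_4(\mathbb{C})$ and an integer $k\ge 0$, let $\varphi_k^\Gamma$ be the E-polynomial of weight $k$ for $\Gamma$, and let $\mathfrak{E}$ (resp. $\mathfrak{E}^8$) be the $\mathbb{C}$-algebra generated by all $\varphi_k^G$ (resp. all $\varphi_k^{G^8}$), $k\ge 0$. Then: (1) $\mathfrak{E}$ is generated by the $\varphi_k^G$ with $k\equiv 0 \bmod 4$ and $8\le k\le 48$; (2) $\mathfrak{E}^8$ is generated by the $\varphi_k^{G^8}$ with $k\equiv 0 \bmod 8$ and $8\le k\le 96$.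
   Context: Let $\mathbf{t}=(t_0,t_1,t_2,t_3)^T$. For a finite matrix group $\Gamma\subset GL_4(\mathbb{C})$ and $\sigma\in\Gamma$, let $\sigma_0$ denote the first row of $\sigma$, so that $\sigma_0\mathbf{t}=\sigma_{00}t_0+\sigma_{01}t_1+\sigma_{02}t_2+\sigma_{03}t_3$ is a linear form. The E-polynomial of weight $k$ for $\Gamma$ is $\varphi_k^\Gamma(\mathbf{t})=\frac{1}{|\Gamma|}\sum_{\sigma\in\Gamma}(\sigma_0\mathbf{t})^k\in\mathbb{C}[t_0,t_1,t_2,t_3]$. (Here $|G|=384$ and $|G^8|=1536$.) *)

theory Defs
  imports
    "HOL-Analysis.Analysis"
    "HOL-Algebra.Generated_Groups"
    "HOL-Library.Poly_Mapping"
begin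

text \<open>
  Coordinates are indexed by the type \<open>4\<close>, enumerated as \<open>1, 2, 3, 4\<close> (the convention of
  \<^const>\<open>vector\<close>) instead of \<open>0, 1, 2, 3\<close>.  So the variable \<open>t\<^sub>0\<close> is \<open>Var 1\<close>, and the first row
  \<open>\<sigma>\<^sub>0\<close> of a matrix \<open>\<sigma>\<close> is \<open>row 1 \<sigma>\<close>.  Beware that \<open>0 = 4\<close> in this type.
\<close>

type_synonym mat4 = "complex^4^4"

lemma vector_4_nth:
  fixes a b c d :: "'a::zero"
  shows "(vector [a, b, c, d] :: 'a^4) $ 1 = a"
    and "(vector [a, b, c, d] :: 'a^4) $ 2 = b"
    and "(vector [a, b, c, d] :: 'a^4) $ 3 = c"
    and "(vector [a, b, c, d] :: 'a^4) $ 4 = d"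
  by (simp_all add: vector_def)

definition GL4 :: "mat4 monoid" where
  "GL4 = \<lparr>carrier = {A. invertible A}, monoid.mult = (**), one = mat 1\<rparr>"

lemma group_GL4: "group GL4"
proof (rule groupI)
  fix x assume "x \<in> carrier GL4"
  then obtain y where "x ** y = mat 1" "y ** x = mat 1"
    by (auto simp: GL4_def invertible_def)
  then show "\<exists>y\<in>carrier GL4. y \<otimes>\<^bsub>GL4\<^esub> x = \<one>\<^bsub>GL4\<^esub>"
    by (auto simp: GL4_def invertible_def)
next
  show "\<one>\<^bsub>GL4\<^esub> \<in> carrier GL4"
    by (auto simp: GL4_def invertible_def intro: exI[of _ "mat 1"])
qed (simp_all add: GL4_def invertible_mult matrix_mul_assoc)

definition diag :: "complex^4 \<Rightarrow> mat4" where
  "diag v = (\<chi> i j. if i = j then v $ i else 0)"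

definition \<eta>8 :: complex where
  "\<eta>8 = exp (2 * complex_of_real pi * \<i> / 8)"

definition gen_S :: mat4 where
  "gen_S = map_matrix (\<lambda>x. \<eta>8 / 2 * x)
     (vector [vector [1,  1,    1,  1],
              vector [1,  \<i>,   -1, -\<i>],
              vector [1, -1,    1, -1],
              vector [1, -\<i>,  -1,  \<i>]])"

definition gen_T :: mat4 where
  "gen_T = diag (vector [1, \<eta>8, -1, \<eta>8])"

lemma \<eta>8_nonzero: "\<eta>8 \<noteq> 0"
  by (simp add: \<eta>8_def)

lemma diag_in_GL4:
  assumes "\<And>i. v $ i \<noteq> 0"
  shows "diag v \<in> carrier GL4"
proof -
  have "diag v ** diag (\<chi> i. 1 / v $ i) = mat 1" "diag (\<chi> i. 1 / v $ i) ** diag v = mat 1"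
    using assms
    by (auto simp: diag_def matrix_matrix_mult_def mat_def vec_eq_iff forall_4 sum_4)
  then show ?thesis
    by (auto simp: GL4_def invertible_def)
qed

lemma gens_in_GL4:
  "gen_S \<in> carrier GL4" "gen_T \<in> carrier GL4"
  "diag (vector [\<eta>8, \<eta>8, \<eta>8, \<eta>8]) \<in> carrier GL4"
proof -
  define B :: mat4 where "B = map_matrix (\<lambda>x. 1 / (2 * \<eta>8) * x)
     (vector [vector [1,  1,    1,  1],
              vector [1, -\<i>,  -1,  \<i>],
              vector [1, -1,    1, -1],
              vector [1,  \<i>,   -1, -\<i>]])"
  have "gen_S ** B = mat 1" "B ** gen_S = mat 1"
    using \<eta>8_nonzero
    by (auto simp: gen_S_def B_def map_matrix_def matrix_matrix_mult_def mat_def vec_eq_iff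
        forall_4 sum_4 vector_4_nth field_simps)
  then show "gen_S \<in> carrier GL4"
    by (auto simp: GL4_def invertible_def)
  have "\<forall>i. (vector [1, \<eta>8, -1, \<eta>8] :: complex^4) $ i \<noteq> 0"
    "\<forall>i. (vector [\<eta>8, \<eta>8, \<eta>8, \<eta>8] :: complex^4) $ i \<noteq> 0"
    using \<eta>8_nonzero by (simp_all add: forall_4 vector_4_nth)
  then show "gen_T \<in> carrier GL4" "diag (vector [\<eta>8, \<eta>8, \<eta>8, \<eta>8]) \<in> carrier GL4"
    by (auto simp: gen_T_def intro: diag_in_GL4)
qed

definition grp_G :: "mat4 set" where
  "grp_G = generate GL4 {gen_S, gen_T}"

definition grp_G8 :: "mat4 set" where
  "grp_G8 = generate GL4 (grp_G \<union> {diag (vector [\<eta>8, \<eta>8, \<eta>8, \<eta>8])})"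


text \<open>
  The polynomial ring \<open>\<complex>[t\<^sub>0, t\<^sub>1, t\<^sub>2, t\<^sub>3]\<close>: finitely supported maps from exponent vectors to
  coefficients, with the convolution product of the library.
\<close>

type_synonym poly4 = "(4 \<Rightarrow>\<^sub>0 nat) \<Rightarrow>\<^sub>0 complex"

definition Const :: "complex \<Rightarrow> poly4" where
  "Const c = Poly_Mapping.single 0 c"

definition Var :: "4 \<Rightarrow> poly4" where
  "Var j = Poly_Mapping.single (Poly_Mapping.single j 1) 1"

definition linear_form :: "complex^4 \<Rightarrow> poly4" where
  "linear_form v = (\<Sum>j\<in>UNIV. Const (v $ j) * Var j)"

text \<open>Meaningful for finite \<open>\<Gamma>\<close> only.\<close>

definition E_poly :: "mat4 set \<Rightarrow> nat \<Rightarrow> poly4" where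
  "E_poly \<Gamma> k = Const (1 / of_nat (card \<Gamma>)) * (\<Sum>\<sigma>\<in>\<Gamma>. linear_form (row 1 \<sigma>) ^ k)"

definition subalgebra :: "poly4 set \<Rightarrow> bool" where
  "subalgebra A \<longleftrightarrow> range Const \<subseteq> A \<and> (\<forall>p\<in>A. \<forall>q\<in>A. p + q \<in> A \<and> p * q \<in> A)"

definition algebra_generated :: "poly4 set \<Rightarrow> poly4 set" where
  "algebra_generated S = subalgebra hull S"

definition E_algebra :: "mat4 set \<Rightarrow> poly4 set" where
  "E_algebra \<Gamma> = algebra_generated (range (E_poly \<Gamma>))"

end

theory Submission
  imports Defs "HOL-Computational_Algebra.Formal_Power_Series"
begin

text \<open>
  Up to scalars, the first rows of the elements of \<open>G\<close> (and of \<open>G\<^sup>8\<close>) form a single orbit of 12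
  lines, and the scalars that occur are the fourth (eighth) roots of unity.  With \<open>m = 4\<close>
  (\<open>m = 8\<close>) and \<open>\<ell>\<^sub>1, \<dots>, \<ell>\<^sub>1\<^sub>2\<close> linear forms on these lines, \<open>\<phi>\<^sub>k\<close> therefore vanishes unless
  \<open>m\<close> divides \<open>k\<close>, and \<open>12 \<phi>\<^sub>m\<^sub>n\<close> is the \<open>n\<close>-th power sum of the 12 polynomials \<open>\<ell>\<^sub>j\<^sup>m\<close>.  By
  Newton's identities the first 12 power sums generate all others.  Finally \<open>\<phi>\<^sub>4 = 0\<close> for \<open>G\<close>.

  Finiteness of the groups is not established: an infinite group would have all \<open>\<phi>\<^sub>k = 0\<close>, because
  sums over infinite sets are \<open>0\<close>.
\<close>

section \<open>Subalgebras and power sums\<close>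

lemma Const_0: "Const 0 = 0"
  by (simp add: Const_def)

lemma Const_1: "Const 1 = 1"
  by (simp add: Const_def)

lemma Const_add: "Const (a + b) = Const a + Const b"
  by (simp add: Const_def single_add)

lemma Const_mult: "Const (a * b) = Const a * Const b"
  by (simp add: Const_def mult_single)

lemma Const_uminus: "Const (- a) = - Const a"
  by (simp add: Const_def single_uminus)

lemma Const_power: "Const (a ^ n) = Const a ^ n"
  by (induction n) (simp_all add: Const_1 Const_mult)

lemma Const_of_nat: "Const (of_nat n) = of_nat n"
  by (induction n) (simp_all add: Const_0 Const_1 Const_add)

lemma subalgebra_Const: "subalgebra A \<Longrightarrow> Const c \<in> A"
  by (auto simp: subalgebra_def)

lemma subalgebra_add: "subalgebra A \<Longrightarrow> p \<in> A \<Longrightarrow> q \<in> A \<Longrightarrow> p + q \<in> A"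
  by (simp add: subalgebra_def)

lemma subalgebra_mult: "subalgebra A \<Longrightarrow> p \<in> A \<Longrightarrow> q \<in> A \<Longrightarrow> p * q \<in> A"
  by (simp add: subalgebra_def)

lemma subalgebra_zero: "subalgebra A \<Longrightarrow> 0 \<in> A"
  using subalgebra_Const[of A 0] by (simp add: Const_0)

lemma subalgebra_uminus: "subalgebra A \<Longrightarrow> p \<in> A \<Longrightarrow> - p \<in> A"
  using subalgebra_mult[of A "Const (- 1)" p] subalgebra_Const[of A "- 1"]
  by (simp add: Const_uminus Const_1)

lemma subalgebra_sum: "subalgebra A \<Longrightarrow> (\<And>i. i \<in> I \<Longrightarrow> f i \<in> A) \<Longrightarrow> sum f I \<in> A"
  by (induction I rule: infinite_finite_induct) (auto intro: subalgebra_zero subalgebra_add)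

text \<open>Constants are complex, so one may multiply by \<open>Const (1 / of_nat n)\<close>. This
  supplies the division by \<open>n\<close> in Newton's identities.\<close>

lemma subalgebra_cancel_of_nat:
  assumes "subalgebra A" "of_nat n * p \<in> A" "n > 0"
  shows "p \<in> A"
proof -
  have "Const (1 / of_nat n) * (of_nat n * p) = Const (1 / of_nat n * of_nat n) * p"
    by (simp only: Const_mult Const_of_nat mult.assoc)
  also have "\<dots> = p"
    using assms(3) by (simp add: Const_1)
  finally show ?thesis
    using assms subalgebra_mult subalgebra_Const by metis
qed

lemma subalgebra_algebra_generated: "subalgebra (algebra_generated S)"
  unfolding algebra_generated_def
  by (rule hull_in) (auto simp: subalgebra_def)

lemma algebra_generated_superset: "S \<subseteq> algebra_generated S"
  unfolding algebra_generated_def by (rule hull_subset)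

lemma algebra_generated_minimal: "S \<subseteq> A \<Longrightarrow> subalgebra A \<Longrightarrow> algebra_generated S \<subseteq> A"
  unfolding algebra_generated_def by (rule hull_minimal)

section \<open>Generating functions and Newton's identities\<close>

text \<open>The coefficient of index \<open>i\<close> is the \<open>i\<close>-th elementary
  symmetric polynomial of \<open>ys\<close> with sign (-1)^i. A power series rather than a
  polynomial, so that it can be multiplied by the generating series of the power sums.\<close>

definition reverse_char_fps :: "'a::comm_ring_1 list \<Rightarrow> 'a fps" where
  "reverse_char_fps ys = prod_list (map (\<lambda>y. 1 - fps_const y * fps_X) ys)"

lemma reverse_char_fps_Cons:
  "reverse_char_fps (y # ys) = (1 - fps_const y * fps_X) * reverse_char_fps ys"
  by (simp add: reverse_char_fps_def)

lemma geometric_fps_shifted: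
  "(1 - fps_const y * fps_X) * Abs_fps (\<lambda>n. y ^ Suc n) = fps_const (y::'a::comm_ring_1)"
proof (rule fps_ext)
  fix n
  show "fps_nth ((1 - fps_const y * fps_X) * Abs_fps (\<lambda>n. y ^ Suc n)) n = fps_nth (fps_const y) n"
    by (cases n) (simp_all add: algebra_simps)
qed

text \<open>The logarithmic derivative of the product of the 1 - y X is minus the sum of the series
  y / (1 - y X). Clearing denominators keeps the identity meaningful over any commutative
  ring.\<close>

lemma fps_deriv_reverse_char_fps:
  "fps_deriv (reverse_char_fps ys) =
     - reverse_char_fps ys * Abs_fps (\<lambda>n. \<Sum>y\<leftarrow>ys. y ^ Suc n)"
proof (induction ys)
  case Nil
  show ?case
    by (simp add: reverse_char_fps_def fps_eq_iff)
next
  case (Cons y ys)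
  define L Q P where "L = 1 - fps_const y * fps_X" and "Q = reverse_char_fps ys"
    and "P = Abs_fps (\<lambda>n. \<Sum>y\<leftarrow>ys. y ^ Suc n)"
  define Y where "Y = Abs_fps (\<lambda>n. y ^ Suc n)"
  have P': "Abs_fps (\<lambda>n. \<Sum>y\<leftarrow>y # ys. y ^ Suc n) = Y + P"
    by (simp add: fps_eq_iff Y_def P_def)
  have "fps_deriv L = - (L * Y)"
    unfolding L_def Y_def geometric_fps_shifted by simp
  then have "fps_deriv (L * Q) = L * (- Q * P) - L * Y * Q"
    using Cons.IH by (simp add: Q_def P_def)
  also have "\<dots> = - (L * Q) * (Y + P)"
    by (simp add: algebra_simps)
  finally show ?case
    unfolding P' by (simp add: reverse_char_fps_Cons L_def Q_def)
qed

lemma reverse_char_fps_nth_0: "fps_nth (reverse_char_fps ys) 0 = 1"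
  by (induction ys) (simp_all add: reverse_char_fps_def)

lemma reverse_char_fps_nth_eq_0: "length ys < n \<Longrightarrow> fps_nth (reverse_char_fps ys) n = 0"
proof (induction ys arbitrary: n)
  case Nil
  then show ?case by (simp add: reverse_char_fps_def)
next
  case (Cons y ys)
  then show ?case
    by (cases n) (simp_all add: reverse_char_fps_Cons algebra_simps)
qed

text \<open>Compare the coefficients of X^n in the formula for the derivative. Past the length of
  \<open>ys\<close> the left side is zero, so the same formula also covers the high power
  sums.\<close>

lemma newton_identity:
  fixes ys :: "'a::comm_ring_1 list"
  shows "of_nat (Suc n) * fps_nth (reverse_char_fps ys) (Suc n) =
    - (\<Sum>i\<le>n. fps_nth (reverse_char_fps ys) i * (\<Sum>y\<leftarrow>ys. y ^ Suc (n - i)))"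
proof -
  have "fps_nth (fps_deriv (reverse_char_fps ys)) n =
      fps_nth (- reverse_char_fps ys * Abs_fps (\<lambda>n. \<Sum>y\<leftarrow>ys. y ^ Suc n)) n"
    by (simp only: fps_deriv_reverse_char_fps)
  then show ?thesis
    by (simp add: fps_mult_nth sum_negf atMost_atLeast0 del: of_nat_Suc power_Suc)
qed

lemma power_sums_in_subalgebra:
  assumes A: "subalgebra A"
    and low: "\<And>n. 1 \<le> n \<Longrightarrow> n \<le> length ys \<Longrightarrow> (\<Sum>y\<leftarrow>ys. y ^ n) \<in> A"
  shows "(\<Sum>y\<leftarrow>ys. y ^ Suc n) \<in> A"
proof -
  define q where "q = reverse_char_fps ys"
  \<comment> \<open>Newton's identity gives each coefficient from earlier ones after division by its
    index. Only indices up to \<open>length ys\<close> use power sums, exactly those covered by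
    \<open>low\<close>; the other coefficients are 1 or 0.\<close>
  have q: "fps_nth q n \<in> A" for n
  proof (induction n rule: less_induct)
    case (less n)
    show ?case
    proof (cases "n = 0 \<or> length ys < n")
      case True
      then show ?thesis
        using subalgebra_Const[OF A, of 1] subalgebra_zero[OF A]
        by (auto simp: q_def reverse_char_fps_nth_0 reverse_char_fps_nth_eq_0 Const_1)
    next
      case False
      then obtain m where m: "n = Suc m" "Suc m \<le> length ys"
        by (cases n) auto
      have "of_nat (Suc m) * fps_nth q (Suc m) \<in> A"
        unfolding q_def newton_identity
        by (intro subalgebra_uminus subalgebra_sum subalgebra_mult A low less[unfolded q_def])
          (use m in auto)
      then show ?thesis
        using subalgebra_cancel_of_nat[OF A] m by blast
    qed
  qed
  show ?thesis
  proof (induction n rule: less_induct)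
    case (less n)
    define s where "s m = (\<Sum>y\<leftarrow>ys. y ^ Suc m)" for m
    \<comment> \<open>The term for index 0 has coefficient 1, so the identity can be solved for the
      top power sum \<open>s n\<close>.\<close>
    have "{..n} = insert 0 {1..n}"
      by auto
    then have "of_nat (Suc n) * fps_nth q (Suc n) = - (s n + (\<Sum>i=1..n. fps_nth q i * s (n - i)))"
      using newton_identity[of n ys]
      by (simp add: q_def s_def reverse_char_fps_nth_0)
    then have "s n = - (Const (of_nat (Suc n)) * fps_nth q (Suc n) + (\<Sum>i=1..n. fps_nth q i * s (n - i)))"
      by (simp only: Const_of_nat) (simp add: algebra_simps)
    also have "\<dots> \<in> A"
      by (intro subalgebra_uminus subalgebra_add subalgebra_sum subalgebra_mult
          subalgebra_Const A q less[folded s_def]) auto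
    finally show ?case
      by (simp add: s_def)
  qed
qed

section \<open>Averages over the orbit of the first row\<close>

lemma row_matrix_mult: "row i (A ** B) = row i A v* B"
  by (simp add: vec_eq_iff row_def matrix_matrix_mult_def vector_matrix_mult_def mult.commute)

lemma scale_vector_matrix_mult: "(c *s v) v* A = c *s (v v* A)"
  for v :: "'a::comm_semiring_1^'n"
  by (simp add: vec_eq_iff vector_matrix_mult_def sum_distrib_left mult.commute mult.left_commute)

lemma linear_form_scale: "linear_form (c *s v) = Const c * linear_form v"
  by (simp add: linear_form_def sum_distrib_left Const_mult mult.assoc)

lemma row_mult_mem:
  assumes "subgroup \<Gamma> GL4" "v \<in> row 1 ` \<Gamma>" "\<tau> \<in> \<Gamma>"
  shows "v v* \<tau> \<in> row 1 ` \<Gamma>"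
  using assms subgroup.m_closed[OF assms(1)]
  by (force simp: row_matrix_mult[symmetric] GL4_def)

lemma sum_subgroup_translate:
  assumes \<Gamma>: "subgroup \<Gamma> GL4" and \<tau>: "\<tau> \<in> \<Gamma>"
  shows "(\<Sum>\<sigma>\<in>\<Gamma>. f (\<tau> ** \<sigma>)) = (\<Sum>\<sigma>\<in>\<Gamma>. f \<sigma>)"
proof -
  interpret group GL4 by (rule group_GL4)
  interpret \<Gamma>: subgroup \<Gamma> GL4 by (rule \<Gamma>)
  have "(\<Sum>\<sigma>\<in>\<Gamma>. f (\<tau> \<otimes>\<^bsub>GL4\<^esub> \<sigma>)) = (\<Sum>\<sigma>\<in>\<Gamma>. f \<sigma>)"
    by (rule sum.reindex_bij_witness[of _ "\<lambda>\<sigma>. inv\<^bsub>GL4\<^esub> \<tau> \<otimes>\<^bsub>GL4\<^esub> \<sigma>" "\<lambda>\<sigma>. \<tau> \<otimes>\<^bsub>GL4\<^esub> \<sigma>"])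
      (use \<tau> in \<open>auto simp: m_assoc[symmetric]\<close>)
  then show ?thesis
    by (simp add: GL4_def)
qed

text \<open>If \<open>v\<close> is the first row of \<tau>, then \<open>v v* \<sigma>\<close> is the
  first row of \<open>\<tau> ** \<sigma>\<close>, and left translation by \<tau> permutes the
  group.\<close>

lemma sum_orbit_vector:
  assumes "subgroup \<Gamma> GL4" "v \<in> row 1 ` \<Gamma>"
  shows "(\<Sum>\<sigma>\<in>\<Gamma>. F (v v* \<sigma>)) = (\<Sum>\<sigma>\<in>\<Gamma>. F (row 1 \<sigma>))"
  using assms sum_subgroup_translate[of \<Gamma> _ "\<lambda>\<sigma>. F (row 1 \<sigma>)"]
  by (auto simp: row_matrix_mult)

text \<open>
  Says that \<open>\<sigma>\<close> permutes the lines spanned by \<open>R\<close> up to \<open>m\<close>-th roots of unity, but as an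
  invariance property, for which closure under products and inverses is immediate.
\<close>

definition line_sum_invariant ::
  "nat \<Rightarrow> (complex^4) list \<Rightarrow> mat4 \<Rightarrow> bool" where
  "line_sum_invariant m R \<sigma> \<longleftrightarrow>
     (\<forall>F :: complex^4 \<Rightarrow> poly4. (\<forall>c v. c ^ m = 1 \<longrightarrow> F (c *s v) = F v) \<longrightarrow>
        (\<Sum>v\<leftarrow>R. F (v v* \<sigma>)) = (\<Sum>v\<leftarrow>R. F v))"

lemma line_sum_invariantD:
  fixes F :: "complex^4 \<Rightarrow> poly4"
  assumes "line_sum_invariant m R \<sigma>" "\<And>c v. c ^ m = 1 \<Longrightarrow> F (c *s v) = F v"
  shows "(\<Sum>v\<leftarrow>R. F (v v* \<sigma>)) = (\<Sum>v\<leftarrow>R. F v)"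
  using assms unfolding line_sum_invariant_def by blast

lemma line_sum_invariant_mult:
  assumes "line_sum_invariant m R \<sigma>" "line_sum_invariant m R \<tau>"
  shows "line_sum_invariant m R (\<sigma> ** \<tau>)"
  unfolding line_sum_invariant_def
proof (intro allI impI)
  fix F :: "complex^4 \<Rightarrow> poly4"
  assume F: "\<forall>c v. c ^ m = 1 \<longrightarrow> F (c *s v) = F v"
  have "(\<Sum>v\<leftarrow>R. F ((v v* \<sigma>) v* \<tau>)) = (\<Sum>v\<leftarrow>R. F (v v* \<tau>))"
    by (rule line_sum_invariantD[OF assms(1)]) (simp add: F scale_vector_matrix_mult)
  also have "\<dots> = (\<Sum>v\<leftarrow>R. F v)"
    by (rule line_sum_invariantD[OF assms(2)]) (simp add: F)
  finally show "(\<Sum>v\<leftarrow>R. F (v v* (\<sigma> ** \<tau>))) = (\<Sum>v\<leftarrow>R. F v)"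
    by (simp add: vector_matrix_mul_assoc)
qed

text \<open>Apply the invariance under \<sigma> to the function sending \<open>v\<close> to
  \<open>F (v v* \<tau>)\<close>, which is again unchanged by \<open>m\<close>-th roots of
  unity.\<close>

lemma line_sum_invariant_right_inverse:
  assumes "line_sum_invariant m R \<sigma>" "\<sigma> ** \<tau> = mat 1"
  shows "line_sum_invariant m R \<tau>"
  unfolding line_sum_invariant_def
proof (intro allI impI)
  fix F :: "complex^4 \<Rightarrow> poly4"
  assume F: "\<forall>c v. c ^ m = 1 \<longrightarrow> F (c *s v) = F v"
  have "(\<Sum>v\<leftarrow>R. F ((v v* \<sigma>) v* \<tau>)) = (\<Sum>v\<leftarrow>R. F (v v* \<tau>))"
    by (rule line_sum_invariantD[OF assms(1)]) (simp add: F scale_vector_matrix_mult)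
  then show "(\<Sum>v\<leftarrow>R. F (v v* \<tau>)) = (\<Sum>v\<leftarrow>R. F v)"
    by (simp add: vector_matrix_mul_assoc assms(2))
qed

lemma line_sum_invariant_generate:
  assumes H: "H \<subseteq> carrier GL4" "\<And>h. h \<in> H \<Longrightarrow> line_sum_invariant m R h"
    and "\<sigma> \<in> generate GL4 H"
  shows "line_sum_invariant m R \<sigma>"
  using assms(3)
proof (induction rule: generate.induct)
  case one
  show ?case
    by (simp add: line_sum_invariant_def GL4_def)
next
  case (incl h)
  then show ?case by (rule H)
next
  case (inv h)
  interpret group GL4 by (rule group_GL4)
  have "h \<otimes>\<^bsub>GL4\<^esub> inv\<^bsub>GL4\<^esub> h = \<one>\<^bsub>GL4\<^esub>"
    using inv H by auto
  then show ?case
    using line_sum_invariant_right_inverse[OF H(2)[OF inv]] by (simp add: GL4_def)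
next
  case (eng h1 h2)
  then show ?case
    using line_sum_invariant_mult by (simp add: GL4_def)
qed

section \<open>E-polynomials as power sums over lines\<close>

lemma E_poly_infinite: "infinite \<Gamma> \<Longrightarrow> E_poly \<Gamma> k = 0"
  by (simp add: E_poly_def)

lemma E_poly_0: "finite \<Gamma> \<Longrightarrow> \<Gamma> \<noteq> {} \<Longrightarrow> E_poly \<Gamma> 0 = 1"
  by (simp add: E_poly_def Const_of_nat[symmetric] Const_mult[symmetric] Const_1)

text \<open>Moving the base point of the orbit from \<open>row 1 (mat 1)\<close> to its multiple by
  \<omega> leaves the sum unchanged, yet multiplies it by \<open>\<omega> ^ k\<close>.\<close>

lemma E_poly_eq_0:
  assumes \<Gamma>: "subgroup \<Gamma> GL4" and \<omega>: "\<omega> *s row 1 (mat 1) \<in> row 1 ` \<Gamma>" "\<omega> ^ k \<noteq> 1"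
  shows "E_poly \<Gamma> k = 0"
proof -
  have row1: "row 1 (mat 1) v* \<sigma> = row 1 \<sigma>" for \<sigma> :: mat4
    by (simp add: row_matrix_mult[symmetric])
  define s where "s = (\<Sum>\<sigma>\<in>\<Gamma>. linear_form (row 1 \<sigma>) ^ k)"
  have "s = (\<Sum>\<sigma>\<in>\<Gamma>. linear_form ((\<omega> *s row 1 (mat 1)) v* \<sigma>) ^ k)"
    unfolding s_def using sum_orbit_vector[OF \<Gamma> \<omega>(1), of "\<lambda>v. linear_form v ^ k"] by simp
  also have "\<dots> = Const (\<omega> ^ k) * s"
    by (simp add: s_def scale_vector_matrix_mult row1 linear_form_scale power_mult_distrib
        sum_distrib_left Const_power)
  finally have "Const (1 - \<omega> ^ k) * s = 0"
    by (simp add: Const_add[of 1 "- _", simplified] Const_uminus Const_1 algebra_simps)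
  then have "Const (inverse (1 - \<omega> ^ k)) * (Const (1 - \<omega> ^ k) * s) = 0"
    by simp
  then have "s = 0"
    using \<omega>(2) by (simp add: mult.assoc[symmetric] Const_mult[symmetric] Const_1)
  then show ?thesis
    by (simp add: E_poly_def s_def)
qed

text \<open>Double counting of the sum of \<open>F (v v* \<sigma>)\<close> over \<open>R\<close> and
  \<Gamma>. For fixed \<open>v\<close> the inner sum is the orbit sum from the base point; for fixed
  \<sigma> it is the sum over \<open>R\<close>, by line invariance.\<close>

lemma E_poly_eq_line_sum:
  assumes \<Gamma>: "subgroup \<Gamma> GL4" "finite \<Gamma>"
    and inv: "\<And>\<sigma>. \<sigma> \<in> \<Gamma> \<Longrightarrow> line_sum_invariant m R \<sigma>"
    and orb: "set R \<subseteq> row 1 ` \<Gamma>" and "m dvd k"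
  shows "of_nat (length R) * E_poly \<Gamma> k = (\<Sum>v\<leftarrow>R. linear_form v ^ k)"
proof -
  define F where "F v = linear_form v ^ k" for v
  have F: "F (c *s v) = F v" if "c ^ m = 1" for c v
  proof -
    have "c ^ k = 1"
      using that \<open>m dvd k\<close> by (auto simp: power_mult)
    then have "Const c ^ k = 1"
      using Const_power[of c k] by (simp add: Const_1)
    then show ?thesis
      by (simp add: F_def linear_form_scale power_mult_distrib)
  qed
  have "\<Gamma> \<noteq> {}"
    using subgroup.one_closed[OF \<Gamma>(1)] by auto
  then have card: "of_nat (card \<Gamma>) \<noteq> (0 :: complex)"
    using \<Gamma>(2) by simp
  have "of_nat (length R) * (\<Sum>\<sigma>\<in>\<Gamma>. F (row 1 \<sigma>)) = (\<Sum>v\<leftarrow>R. \<Sum>\<sigma>\<in>\<Gamma>. F (row 1 \<sigma>))"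
    by (simp add: sum_list_triv)
  also have "\<dots> = (\<Sum>v\<leftarrow>R. \<Sum>\<sigma>\<in>\<Gamma>. F (v v* \<sigma>))"
    using orb by (intro arg_cong[of _ _ sum_list] map_cong refl)
      (auto intro!: sum_orbit_vector[OF \<Gamma>(1), symmetric])
  also have "\<dots> = (\<Sum>\<sigma>\<in>\<Gamma>. \<Sum>v\<leftarrow>R. F (v v* \<sigma>))"
    by (induction R) (simp_all add: sum.distrib)
  also have "\<dots> = (\<Sum>\<sigma>\<in>\<Gamma>. \<Sum>v\<leftarrow>R. F v)"
    by (intro sum.cong refl line_sum_invariantD[OF inv] F)
  also have "\<dots> = Const (of_nat (card \<Gamma>)) * (\<Sum>v\<leftarrow>R. F v)"
    by (simp add: Const_of_nat)
  finally have "Const (1 / of_nat (card \<Gamma>)) * (of_nat (length R) * (\<Sum>\<sigma>\<in>\<Gamma>. F (row 1 \<sigma>))) =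
      Const (1 / of_nat (card \<Gamma>) * of_nat (card \<Gamma>)) * (\<Sum>v\<leftarrow>R. F v)"
    by (simp only: Const_mult mult.assoc)
  then show ?thesis
    using card by (simp add: E_poly_def F_def Const_1 mult.left_commute)
qed

text \<open>The scalar \<omega> kills all weights not divisible by \<open>m\<close>, and Newton's
  identities reduce the remaining ones to the first \<open>length R\<close> multiples of
  \<open>m\<close>. The alternative in \<open>low\<close> lets a weight be left out of
  \<open>K\<close> when its power sum vanishes.\<close>

lemma E_algebra_eq_generated:
  assumes \<Gamma>: "subgroup \<Gamma> GL4"
    and inv: "\<And>\<sigma>. \<sigma> \<in> \<Gamma> \<Longrightarrow> line_sum_invariant m R \<sigma>"
    and orb: "set R \<subseteq> row 1 ` \<Gamma>" and "R \<noteq> []"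
    and \<omega>: "\<omega> *s row 1 (mat 1) \<in> row 1 ` \<Gamma>" "\<And>k. \<omega> ^ k = 1 \<Longrightarrow> m dvd k"
    and low: "\<And>n. 1 \<le> n \<Longrightarrow> n \<le> length R \<Longrightarrow>
      (\<Sum>v\<leftarrow>R. linear_form v ^ (m * n)) = 0 \<or> m * n \<in> K"
  shows "E_algebra \<Gamma> = algebra_generated (E_poly \<Gamma> ` K)"
proof
  let ?A = "algebra_generated (E_poly \<Gamma> ` K)"
  note A = subalgebra_algebra_generated[of "E_poly \<Gamma> ` K"]
  show "?A \<subseteq> E_algebra \<Gamma>"
    unfolding E_algebra_def
    by (rule algebra_generated_minimal[OF _ subalgebra_algebra_generated])
      (rule subset_trans[OF image_mono[OF subset_UNIV] algebra_generated_superset])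
  have "E_poly \<Gamma> k \<in> ?A" for k
  proof (cases "finite \<Gamma> \<and> m dvd k \<and> k \<noteq> 0")
    case False
    have "\<Gamma> \<noteq> {}"
      using subgroup.one_closed[OF \<Gamma>] by auto
    then have "E_poly \<Gamma> k = 0 \<or> E_poly \<Gamma> k = 1"
      using False E_poly_infinite E_poly_0 E_poly_eq_0[OF \<Gamma> \<omega>(1)] \<omega>(2) by metis
    then show ?thesis
      using subalgebra_zero[OF A] subalgebra_Const[OF A, of 1] by (auto simp: Const_1)
  next
    case True
    then have fin: "finite \<Gamma>" and "k \<noteq> 0" by auto
    from True obtain n where k: "k = m * Suc n"
      by (metis dvdE mult_0_right not0_implies_Suc)
    \<comment> \<open>Newton's identities are applied to the \<open>m\<close>-th powers of the
      forms, whose \<open>n\<close>-th power sum has weight \<open>m * n\<close>.\<close>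
    define ys where "ys = map (\<lambda>v. linear_form v ^ m) R"
    have ys: "(\<Sum>y\<leftarrow>ys. y ^ n) = (\<Sum>v\<leftarrow>R. linear_form v ^ (m * n))" for n
      by (simp add: ys_def o_def power_mult)
    have line_sum: "of_nat (length R) * E_poly \<Gamma> (m * n) = (\<Sum>v\<leftarrow>R. linear_form v ^ (m * n))"
      for n by (rule E_poly_eq_line_sum[OF \<Gamma> fin inv orb]) auto
    have "(\<Sum>y\<leftarrow>ys. y ^ Suc n) \<in> ?A"
    proof (rule power_sums_in_subalgebra[OF A])
      fix n assume "1 \<le> n" "n \<le> length ys"
      then consider "(\<Sum>v\<leftarrow>R. linear_form v ^ (m * n)) = 0" | "m * n \<in> K"
        using low[of n] by (auto simp: ys_def)
      then show "(\<Sum>y\<leftarrow>ys. y ^ n) \<in> ?A"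
      proof cases
        case 1
        then show ?thesis
          unfolding ys using subalgebra_zero[OF A] by simp
      next
        case 2
        then have "E_poly \<Gamma> (m * n) \<in> ?A"
          using algebra_generated_superset by blast
        then show ?thesis
          unfolding ys line_sum[symmetric] Const_of_nat[symmetric]
          by (intro subalgebra_mult A subalgebra_Const)
      qed
    qed
    then have "of_nat (length R) * E_poly \<Gamma> k \<in> ?A"
      unfolding ys line_sum[symmetric] k .
    then show ?thesis
      using subalgebra_cancel_of_nat[OF A] \<open>R \<noteq> []\<close> by blast
  qed
  then show "E_algebra \<Gamma> \<subseteq> ?A"
    unfolding E_algebra_def by (intro algebra_generated_minimal A) auto
qed

section \<open>The twelve lines\<close>

lemma \<eta>8_mult_self: "\<eta>8 * \<eta>8 = \<i>"
proof -
  have "\<eta>8 * \<eta>8 = exp (\<i> * complex_of_real (pi / 2))"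
    unfolding \<eta>8_def exp_add[symmetric] by (simp add: field_simps)
  also have "\<dots> = cis (pi / 2)"
    by (rule cis_conv_exp[symmetric])
  also have "\<dots> = \<i>"
    by simp
  finally show ?thesis .
qed

lemma \<eta>8_mult_self_left: "\<eta>8 * (\<eta>8 * x) = \<i> * x"
  by (simp add: mult.assoc[symmetric] \<eta>8_mult_self)

lemma ii_power_eq_1_imp_4_dvd:
  assumes "\<i> ^ k = 1"
  shows "4 dvd k"
proof -
  have "(- 1 :: complex) ^ k = (\<i> ^ k)\<^sup>2"
    by (simp add: power_mult[symmetric] mult.commute[of k] power_mult[of _ 2])
  then have "even k"
    using assms by (cases "even k") auto
  then obtain q where q: "k = 2 * q" ..
  then have "(- 1 :: complex) ^ q = 1"
    using assms by (simp add: power_mult)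
  then have "even q"
    by (cases "even q") auto
  then show ?thesis
    using q by auto
qed

text \<open>Squaring reduces to powers of \<open>\<i>\<close> and gives \<open>k = 4 * q\<close>;
  since \<open>\<eta>8 ^ 4\<close> is -1, \<open>q\<close> must be even.\<close>

lemma \<eta>8_power_eq_1_imp_8_dvd:
  assumes "\<eta>8 ^ k = 1"
  shows "8 dvd k"
proof -
  have "\<i> ^ k = (\<eta>8 ^ k)\<^sup>2"
    by (simp add: \<eta>8_mult_self[symmetric] power_mult_distrib power2_eq_square)
  then obtain q where q: "k = 4 * q"
    using assms ii_power_eq_1_imp_4_dvd[of k] by auto
  have "\<eta>8 ^ 4 = - 1"
    by (simp add: eval_nat_numeral \<eta>8_mult_self \<eta>8_mult_self_left)
  then have "(- 1 :: complex) ^ q = 1"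
    using assms q by (simp add: power_mult)
  then have "even q"
    by (cases "even q") auto
  then show ?thesis
    using q by auto
qed

text \<open>Every first row has equal second and fourth entries, so three coordinates suffice.\<close>

definition sym_vec :: "complex \<Rightarrow> complex \<Rightarrow> complex \<Rightarrow> complex^4" where
  "sym_vec a b c = vector [a, b, c, b]"

lemma sym_vec_gen_S:
  "sym_vec a b c v* gen_S =
     sym_vec (\<eta>8 / 2 * (a + 2 * b + c)) (\<eta>8 / 2 * (a - c)) (\<eta>8 / 2 * (a - 2 * b + c))"
  by (simp add: sym_vec_def gen_S_def map_matrix_def vector_matrix_mult_def vec_eq_iff
      forall_4 sum_4 vector_4_nth algebra_simps)

lemma sym_vec_gen_T: "sym_vec a b c v* gen_T = sym_vec a (\<eta>8 * b) (- c)"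
  by (simp add: sym_vec_def gen_T_def diag_def vector_matrix_mult_def vec_eq_iff
      forall_4 sum_4 vector_4_nth)

lemma scale_sym_vec: "t *s sym_vec a b c = sym_vec (t * a) (t * b) (t * c)"
  by (simp add: sym_vec_def vec_eq_iff forall_4 vector_4_nth)

lemma sym_vec_eq_iff: "sym_vec a b c = sym_vec a' b' c' \<longleftrightarrow> a = a' \<and> b = b' \<and> c = c'"
  by (auto simp: sym_vec_def vec_eq_iff forall_4 vector_4_nth)

lemma row_1_mat_1: "row 1 (mat 1) = sym_vec 1 0 0"
  by (simp add: sym_vec_def row_def mat_def vec_eq_iff forall_4 vector_4_nth)

lemma linear_form_sym_vec:
  "linear_form (sym_vec a b c) = Const a * Var 1 + Const b * (Var 2 + Var 4) + Const c * Var 3"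
  by (simp add: linear_form_def sym_vec_def sum_4 vector_4_nth algebra_simps)

text \<open>In the coordinates of \<open>sym_vec\<close> the lines are spanned by (1,0,0), (0,0,1),
  (1,0,i), (1,0,-i), the (1,z,1) with z^4 = 1 and the (1,z,-1) with z^4 = -1. The scalars are chosen
  so that every representative is itself a first row of an element of G.\<close>

definition line_reps :: "(complex^4) list" where
  "line_reps =
    [sym_vec 1 0 0, sym_vec 0 0 1,
     sym_vec ((1 + \<i>) / 2) 0 ((\<i> - 1) / 2), sym_vec ((1 + \<i>) / 2) 0 ((1 - \<i>) / 2),
     sym_vec (\<eta>8 / 2) (\<eta>8 / 2) (\<eta>8 / 2), sym_vec (\<eta>8 / 2) (\<i> * \<eta>8 / 2) (\<eta>8 / 2),
     sym_vec (\<eta>8 / 2) (- \<eta>8 / 2) (\<eta>8 / 2), sym_vec (\<eta>8 / 2) (- \<i> * \<eta>8 / 2) (\<eta>8 / 2),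
     sym_vec (\<eta>8 / 2) (\<i> / 2) (- \<eta>8 / 2), sym_vec (\<eta>8 / 2) (- 1 / 2) (- \<eta>8 / 2),
     sym_vec (\<eta>8 / 2) (- \<i> / 2) (- \<eta>8 / 2), sym_vec (\<eta>8 / 2) (1 / 2) (- \<eta>8 / 2)]"

text \<open>The factors \<open>c i\<close> are absorbed by \<open>F\<close>, so only the order of
  summation changes. Stating the permutation as an equality of multisets makes it checkable by
  simplification on an explicit list.\<close>

lemma line_sum_invariant_if_permuted:
  assumes "mset (map (\<lambda>i. R ! \<pi> i) [0..<length R]) = mset R"
    and "\<And>i. i < length R \<Longrightarrow> c i ^ m = 1 \<and> R ! i v* \<sigma> = c i *s (R ! \<pi> i)"
  shows "line_sum_invariant m R \<sigma>"
  unfolding line_sum_invariant_def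
proof (intro allI impI)
  fix F :: "complex^4 \<Rightarrow> poly4"
  assume F: "\<forall>c v. c ^ m = 1 \<longrightarrow> F (c *s v) = F v"
  have "map (\<lambda>v. F (v v* \<sigma>)) R = map F (map (\<lambda>i. R ! \<pi> i) [0..<length R])"
    by (rule nth_equalityI) (use assms(2) F in auto)
  also have "sum_list \<dots> = sum_mset (image_mset F (mset (map (\<lambda>i. R ! \<pi> i) [0..<length R])))"
    by (simp only: mset_map[symmetric] sum_mset_sum_list)
  also have "\<dots> = (\<Sum>v\<leftarrow>R. F v)"
    by (simp only: assms(1) mset_map[symmetric] sum_mset_sum_list)
  finally show "(\<Sum>v\<leftarrow>R. F (v v* \<sigma>)) = (\<Sum>v\<leftarrow>R. F v)" .
qed

lemma length_line_reps: "length line_reps = 12"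
  by (simp add: line_reps_def)

lemma upt_12: "[0..<12] = [0, 1, 2, 3, 4, 5, 6, 7, 8, 9, 10, 11 :: nat]"
  by (simp add: upt_rec)

lemma line_sum_invariant_gen_S: "line_sum_invariant 4 line_reps gen_S"
proof (rule line_sum_invariant_if_permuted)
  \<comment> \<open>Tables read off from \<open>sym_vec_gen_S\<close>, with positions counted from
    0.\<close>
  let ?\<pi> = "\<lambda>i. [4, 6, 7, 5, 0, 3, 1, 2, 11, 10, 9, 8 :: nat] ! i"
  let ?c = "\<lambda>i. [1, 1, \<i>, 1, \<i>, \<i>, \<i>, 1, \<i>, - 1, - \<i>, 1] ! i"
  show "mset (map (\<lambda>i. line_reps ! ?\<pi> i) [0..<length line_reps]) = mset line_reps"
    unfolding length_line_reps upt_12 by (simp add: line_reps_def)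
  fix i assume "i < length line_reps"
  then have "i \<in> set [0..<12]"
    by (simp add: length_line_reps)
  then show "?c i ^ 4 = 1 \<and> line_reps ! i v* gen_S = ?c i *s (line_reps ! ?\<pi> i)"
    unfolding upt_12
    by (auto simp: line_reps_def sym_vec_gen_S scale_sym_vec sym_vec_eq_iff field_simps
        \<eta>8_mult_self \<eta>8_mult_self_left)
qed

lemma line_sum_invariant_gen_T: "line_sum_invariant 4 line_reps gen_T"
proof (rule line_sum_invariant_if_permuted)
  \<comment> \<open>\<open>gen_T\<close> fixes the first two lines, swaps the next two and moves the
    last eight in a single cycle. The only scalar other than 1 is -1, on (0,0,1).\<close>
  let ?\<pi> = "\<lambda>i. [0, 1, 3, 2, 8, 9, 10, 11, 5, 6, 7, 4 :: nat] ! i"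
  let ?c = "\<lambda>i. if i = 1 then - 1 else 1 :: complex"
  show "mset (map (\<lambda>i. line_reps ! ?\<pi> i) [0..<length line_reps]) = mset line_reps"
    unfolding length_line_reps upt_12 by (simp add: line_reps_def)
  fix i assume "i < length line_reps"
  then have "i \<in> set [0..<12]"
    by (simp add: length_line_reps)
  then show "?c i ^ 4 = 1 \<and> line_reps ! i v* gen_T = ?c i *s (line_reps ! ?\<pi> i)"
    unfolding upt_12
    by (auto simp: line_reps_def sym_vec_gen_T scale_sym_vec sym_vec_eq_iff field_simps
        \<eta>8_mult_self \<eta>8_mult_self_left)
qed

lemma line_sum_invariant_dvd:
  assumes "line_sum_invariant m R \<sigma>" "m dvd n"
  shows "line_sum_invariant n R \<sigma>"
  using assms by (auto simp: line_sum_invariant_def power_mult)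

lemma line_sum_invariant_scalar:
  assumes "\<And>v. v v* \<sigma> = \<omega> *s v" "\<omega> ^ m = 1"
  shows "line_sum_invariant m R \<sigma>"
  using assms by (simp add: line_sum_invariant_def)

text \<open>This is what removes weight 4 from the generators for G. It is a polynomial identity in
  \<open>x\<close>, \<open>y\<close>, \<open>z\<close> modulo the relations \<open>HH\<close> and
  \<open>DD\<close>.\<close>

lemma line_sum_4_eq_0: "(\<Sum>v\<leftarrow>line_reps. linear_form v ^ 4) = 0"
proof -
  define x y z where "x = Var 1" and "y = Var 2 + Var 4" and "z = Var 3"
  define H D where "H = Const \<eta>8" and "D = Const (1 / 2)"
  have HH: "H * H * (H * H) = - 1"
    unfolding H_def Const_mult[symmetric] \<eta>8_mult_self by (simp add: Const_uminus Const_1)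
  have HH_left: "H * (H * (H * (H * a))) = - a" for a
    using HH by algebra
  have DD: "2 * D = 1"
    using Const_add[of "1/2" "1/2"] by (simp add: D_def Const_1)
  have I: "Const \<i> = H * H"
    unfolding H_def Const_mult[symmetric] \<eta>8_mult_self ..
  have form: "linear_form (sym_vec a b c) = Const a * x + Const b * y + Const c * z" for a b c
    by (simp add: linear_form_sym_vec x_def y_def z_def)
  have half: "Const (a / 2) = D * Const a" for a
    using Const_mult[of "1 / 2" a] by (simp add: D_def)
  have diff: "Const (a - b) = Const a - Const b" for a b
    using Const_add[of a "- b"] by (simp add: Const_uminus)
  \<comment> \<open>Summing (u + z w)^4 over z^4 = 1 leaves only 4 (u^4 + w^4). The last eight lines
    form two such groups of four, with \<open>u = x + z\<close>, \<open>w = y\<close> and with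
    \<open>u = x - z\<close>, \<open>w = H * y\<close>.\<close>
  have pair: "(D * H * (u + w)) ^ 4 + (D * H * (u + H * H * w)) ^ 4 +
      (D * H * (u - w)) ^ 4 + (D * H * (u - H * H * w)) ^ 4 = - (D * D * (u ^ 4 + w ^ 4))" for u w
    using HH DD by algebra
  have "(\<Sum>v\<leftarrow>line_reps. linear_form v ^ 4) = 
    x ^ 4 + z ^ 4 + (D * (1 + H * H) * x + D * (H * H - 1) * z) ^ 4
      + (D * (1 + H * H) * x + D * (1 - H * H) * z) ^ 4
      - D * D * ((x + z) ^ 4 + y ^ 4) - D * D * ((x - z) ^ 4 + (H * y) ^ 4)"
    unfolding diff_conv_add_uminus pair[symmetric]
    by (simp add: line_reps_def form half diff Const_add Const_mult Const_uminus Const_0 Const_1 I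
        H_def[symmetric] HH_left algebra_simps)
  also have "\<dots> = 0"
    using HH DD by algebra
  finally show ?thesis .
qed

section \<open>The groups G and G^8\<close>

lemma subgroup_grp_G: "subgroup grp_G GL4"
  unfolding grp_G_def
  by (rule group.generate_is_subgroup[OF group_GL4]) (use gens_in_GL4 in auto)

lemma grp_G8_gens_subset:
  "grp_G \<union> {diag (vector [\<eta>8, \<eta>8, \<eta>8, \<eta>8])} \<subseteq> carrier GL4"
  using subgroup.subset[OF subgroup_grp_G] gens_in_GL4 by auto

lemma subgroup_grp_G8: "subgroup grp_G8 GL4"
  unfolding grp_G8_def
  by (rule group.generate_is_subgroup[OF group_GL4 grp_G8_gens_subset])

lemma vector_matrix_mult_scalar_\<eta>8: "v v* diag (vector [\<eta>8, \<eta>8, \<eta>8, \<eta>8]) = \<eta>8 *s v"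
  by (simp add: diag_def vector_matrix_mult_def vec_eq_iff forall_4 sum_4 vector_4_nth)

lemma line_sum_invariant_grp_G:
  assumes "\<sigma> \<in> grp_G"
  shows "line_sum_invariant 4 line_reps \<sigma>"
  by (rule line_sum_invariant_generate[of "{gen_S, gen_T}"])
    (use assms gens_in_GL4 line_sum_invariant_gen_S line_sum_invariant_gen_T
      in \<open>auto simp: grp_G_def\<close>)

text \<open>Passing from 4 to 8 weakens the invariance, so elements of G keep it, while the added
  scalar matrix, whose eighth power is the identity, now satisfies it too.\<close>

lemma line_sum_invariant_grp_G8:
  assumes "\<sigma> \<in> grp_G8"
  shows "line_sum_invariant 8 line_reps \<sigma>"
proof (rule line_sum_invariant_generate[OF grp_G8_gens_subset _ assms[unfolded grp_G8_def]])
  fix h assume "h \<in> grp_G \<union> {diag (vector [\<eta>8, \<eta>8, \<eta>8, \<eta>8])}"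
  moreover have "\<eta>8 ^ 8 = 1"
    by (simp add: eval_nat_numeral \<eta>8_mult_self \<eta>8_mult_self_left)
  ultimately show "line_sum_invariant 8 line_reps h"
    using line_sum_invariant_dvd[OF line_sum_invariant_grp_G, of _ 8]
      line_sum_invariant_scalar[OF vector_matrix_mult_scalar_\<eta>8, of 8] by auto
qed

lemma orbit_grp_G:
  shows ii_row_mem_grp_G: "\<i> *s row 1 (mat 1) \<in> row 1 ` grp_G"
    and line_reps_subset_grp_G: "set line_reps \<subseteq> row 1 ` grp_G"
proof -
  let ?O = "row 1 ` grp_G"
  have "mat 1 \<in> grp_G"
    using subgroup.one_closed[OF subgroup_grp_G] by (simp add: GL4_def)
  then have r0: "sym_vec 1 0 0 \<in> ?O"
    by (metis row_1_mat_1 imageI)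
  have S: "v v* gen_S \<in> ?O" and T: "v v* gen_T \<in> ?O" if "v \<in> ?O" for v
    using row_mult_mem[OF subgroup_grp_G that] by (simp_all add: grp_G_def generate.incl)
  have r4: "sym_vec (\<eta>8 / 2) (\<eta>8 / 2) (\<eta>8 / 2) \<in> ?O"
    using S[OF r0] by (simp add: sym_vec_gen_S)
  show ii: "\<i> *s row 1 (mat 1) \<in> ?O"
    using S[OF r4] by (simp add: sym_vec_gen_S row_1_mat_1 scale_sym_vec \<eta>8_mult_self)
  \<comment> \<open>Applying \<open>gen_S\<close> twice to the base point multiplies it by
    \<open>\<i>\<close>; acting by \<tau> carries this factor to the whole orbit.\<close>
  have scale: "\<i> *s v \<in> ?O" if v: "v \<in> ?O" for v
  proof -
    obtain \<tau> where \<tau>: "\<tau> \<in> grp_G" "v = row 1 \<tau>"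
      using v by auto
    then show ?thesis
      using row_mult_mem[OF subgroup_grp_G ii \<tau>(1)]
      by (simp add: scale_vector_matrix_mult row_matrix_mult[symmetric])
  qed
  note simps = sym_vec_gen_S sym_vec_gen_T scale_sym_vec \<eta>8_mult_self \<eta>8_mult_self_left field_simps
  \<comment> \<open>From here on \<open>gen_T\<close> runs through its cycle of length eight,
    starting at \<open>r4\<close>.\<close>
  have r8: "sym_vec (\<eta>8 / 2) (\<i> / 2) (- \<eta>8 / 2) \<in> ?O"
    using T[OF r4] by (simp add: simps)
  have r5: "sym_vec (\<eta>8 / 2) (\<i> * \<eta>8 / 2) (\<eta>8 / 2) \<in> ?O"
    using T[OF r8] by (simp add: simps)
  have r9: "sym_vec (\<eta>8 / 2) (- 1 / 2) (- \<eta>8 / 2) \<in> ?O"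
    using T[OF r5] by (simp add: simps)
  have r6: "sym_vec (\<eta>8 / 2) (- \<eta>8 / 2) (\<eta>8 / 2) \<in> ?O"
    using T[OF r9] by (simp add: simps)
  have r10: "sym_vec (\<eta>8 / 2) (- \<i> / 2) (- \<eta>8 / 2) \<in> ?O"
    using T[OF r6] by (simp add: simps)
  have r7: "sym_vec (\<eta>8 / 2) (- \<i> * \<eta>8 / 2) (\<eta>8 / 2) \<in> ?O"
    using T[OF r10] by (simp add: simps)
  have r11: "sym_vec (\<eta>8 / 2) (1 / 2) (- \<eta>8 / 2) \<in> ?O"
    using T[OF r7] by (simp add: simps)
  \<comment> \<open>\<open>gen_S\<close> produces this vector with a factor \<open>\<i>\<close>,
    which three further factors \<open>\<i>\<close> cancel; the same holds for
    \<open>r3\<close>.\<close>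
  have r1: "sym_vec 0 0 1 \<in> ?O"
    using scale[OF scale[OF scale[OF S[OF r6]]]] by (simp add: simps)
  have r3: "sym_vec ((1 + \<i>) / 2) 0 ((1 - \<i>) / 2) \<in> ?O"
  proof -
    have "\<i> *s (\<i> *s (\<i> *s (sym_vec (\<eta>8 / 2) (\<i> * \<eta>8 / 2) (\<eta>8 / 2) v* gen_S))) =
        sym_vec ((1 + \<i>) / 2) 0 ((1 - \<i>) / 2)"
      by (simp add: simps sym_vec_eq_iff)
    then show ?thesis
      using scale[OF scale[OF scale[OF S[OF r5]]]] by simp
  qed
  have r2: "sym_vec ((1 + \<i>) / 2) 0 ((\<i> - 1) / 2) \<in> ?O"
    using T[OF r3] by (simp add: sym_vec_gen_T minus_divide_left)
  show "set line_reps \<subseteq> ?O"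
    using r0 r1 r2 r3 r4 r5 r6 r7 r8 r9 r10 r11 by (simp add: line_reps_def)
qed

lemma grp_G_subset_grp_G8: "grp_G \<subseteq> grp_G8"
  by (auto simp: grp_G8_def intro: generate.incl)

lemma \<eta>8_row_mem_grp_G8: "\<eta>8 *s row 1 (mat 1) \<in> row 1 ` grp_G8"
proof -
  let ?Z = "diag (vector [\<eta>8, \<eta>8, \<eta>8, \<eta>8])"
  have "row 1 ?Z = \<eta>8 *s row 1 (mat 1)"
    by (metis row_matrix_mult vector_matrix_mult_scalar_\<eta>8 matrix_mul_lid)
  moreover have "?Z \<in> grp_G8"
    by (auto simp: grp_G8_def intro: generate.incl)
  ultimately show ?thesis
    by (metis imageI)
qed

theorem theorem3:
  shows
    "E_algebra grp_G =
       algebra_generated (E_poly grp_G ` {k. k mod 4 = 0 \<and> 8 \<le> k \<and> k \<le> 48}) \<and>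
     E_algebra grp_G8 =
       algebra_generated (E_poly grp_G8 ` {k. k mod 8 = 0 \<and> 8 \<le> k \<and> k \<le> 96})"
proof
  show "E_algebra grp_G =
      algebra_generated (E_poly grp_G ` {k. k mod 4 = 0 \<and> 8 \<le> k \<and> k \<le> 48})"
  proof (rule E_algebra_eq_generated[OF subgroup_grp_G line_sum_invariant_grp_G
        line_reps_subset_grp_G _ ii_row_mem_grp_G ii_power_eq_1_imp_4_dvd])
    \<comment> \<open>Weight 4 is the vanishing case \<open>n = 1\<close>; the values 2 to 12 of
      \<open>n\<close> give the weights 8 to 48.\<close>
    fix n :: nat assume "1 \<le> n" "n \<le> length line_reps"
    then show "(\<Sum>v\<leftarrow>line_reps. linear_form v ^ (4 * n)) = 0 \<or>
        4 * n \<in> {k. k mod 4 = 0 \<and> 8 \<le> k \<and> k \<le> 48}"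
      using line_sum_4_eq_0 by (cases "n = 1") (auto simp: length_line_reps)
  qed (simp_all add: line_reps_def)
  show "E_algebra grp_G8 =
      algebra_generated (E_poly grp_G8 ` {k. k mod 8 = 0 \<and> 8 \<le> k \<and> k \<le> 96})"
  \<comment> \<open>With \<open>m = 8\<close> the weights are 8 to 96 and all twelve lie in the
    index set.\<close>
  proof (rule E_algebra_eq_generated[OF subgroup_grp_G8 line_sum_invariant_grp_G8
        _ _ \<eta>8_row_mem_grp_G8 \<eta>8_power_eq_1_imp_8_dvd])
    show "set line_reps \<subseteq> row 1 ` grp_G8"
      using line_reps_subset_grp_G grp_G_subset_grp_G8 by blast
  qed (auto simp: length_line_reps line_reps_def)
qed

end
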